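(* Let $\mathcal{F}=\{F_i : i\in\mathbb{N}\}$ be a countable family of similarities of $\mathbb{R}^n$ of the form $F_i(\mathbf{x})=r_i\mathbf{x}+\mathbf{b}_i$ with $r_i\in\mathbb{R}$, $|r_i|<1$ and $\mathbf{b}_i\in\mathbb{R}^n$. If there exists a unique bounded invariant set for $\mathcal{F}$, then $r:=\sup_i|r_i|<1$.
   Context: A non-empty set $E\subset\mathbb{R}^n$ is an invariant set for $\mathcal{F}$ if $E=\overline{\bigcup_{i=1}^\infty F_i(E)}$. *)

theory Defs
  imports "HOL-Analysis.Analysis"
begin

definition invariant_set ::
  "(nat \<Rightarrow> 'a::topological_space \<Rightarrow> 'a) \<Rightarrow> 'a set \<Rightarrow> bool" where
  "invariant_set F E \<longleftrightarrow> E \<noteq> {} \<and> E = closure (\<Union>i. F i ` E)"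

end

theory Submission imports Defs begin

text \<open>
  Write \<open>\<Phi> A\<close> for the closure of the union of the images \<open>F i ` A\<close>. Suppose the supremum of
  the \<open>\<bar>r i\<bar>\<close> is \<open>1\<close> and \<open>E\<close> is a bounded invariant set; then \<open>E\<close> is compact, and its closed
  \<open>1\<close>-neighbourhood \<open>N\<close> turns out to be a second bounded invariant set.

  Each map sends \<open>N\<close> into itself because it sends \<open>E\<close> into itself and does not expand distances,
  so \<open>\<Phi> N \<subseteq> N\<close>. For the reverse inclusion, the offsets \<open>b i\<close> are bounded because the maps
  preserve \<open>E\<close>, so some sequence of maps with \<open>\<bar>r i\<bar> \<rightarrow> 1\<close> has a pointwise limit \<open>G x = s x + c\<close>
  with \<open>\<bar>s\<bar> = 1\<close> (lemma \<open>limit_of_similarities\<close>). The limit preserves the closed set \<open>E\<close>, and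
  \<open>G \<circ> G\<close> is a translation because \<open>s\<^sup>2 = 1\<close>; a bounded set is preserved by no translation other
  than the identity (lemma \<open>translation_preserving_bounded_trivial\<close>), so \<open>G\<close> is an involution.
  Hence a point \<open>y\<close> of \<open>N\<close> is the limit of images of the point \<open>G y\<close>, which again lies in \<open>N\<close>,
  and therefore \<open>N \<subseteq> \<Phi> N\<close>. Finally \<open>N \<noteq> E\<close>: otherwise \<open>E\<close> would be preserved by translation by
  a unit vector.
\<close>

text \<open>
  Iterating the translation puts the unbounded sequence \<open>x + n v\<close> into \<open>S\<close> unless \<open>v = 0\<close>.
\<close>

lemma translation_preserving_bounded_trivial:
  fixes S :: "'a::real_normed_vector set"
  assumes "bounded S" "S \<noteq> {}" and v: "\<And>x. x \<in> S \<Longrightarrow> x + v \<in> S"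
  shows "v = 0"
proof (rule ccontr)
  assume "v \<noteq> 0"
  obtain x B where x: "x \<in> S" and B: "\<And>y. y \<in> S \<Longrightarrow> norm y \<le> B"
    using assms(1,2) unfolding bounded_iff by blast
  have "x + real n *\<^sub>R v \<in> S" for n
  proof (induction n)
    case (Suc n)
    then show ?case using v[OF Suc] by (simp add: algebra_simps)
  qed (simp add: x)
  then have bound: "norm (x + real n *\<^sub>R v) \<le> B" for n
    using B by blast
  obtain n where n: "2 * B < real n * norm v"
    using reals_Archimedean3[of "norm v"] \<open>v \<noteq> 0\<close> by auto
  have "real n * norm v = norm ((x + real n *\<^sub>R v) - x)"
    by simp
  also have "\<dots> \<le> B + B"
    using norm_triangle_ineq4[of "x + real n *\<^sub>R v" x] bound[of n] B[OF x] by linarith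
  finally show False
    using n by simp
qed

lemma invariant_set_closed: "invariant_set F E \<Longrightarrow> closed E"
  unfolding invariant_set_def by (metis closed_closure)

lemma invariant_set_image: "invariant_set F E \<Longrightarrow> x \<in> E \<Longrightarrow> F i x \<in> E"
  unfolding invariant_set_def by (metis UN_I UNIV_I closure_subset imageI subsetD)

text \<open>
  Preserving the bounded set \<open>E\<close> bounds the offsets, since \<open>b i = F i e - r i e\<close> for any \<open>e\<close> in
  \<open>E\<close>. So the pairs \<open>(r i, b i)\<close> along indices with \<open>\<bar>r i\<bar> \<rightarrow> 1\<close> have a convergent subsequence.
\<close>

lemma limit_of_similarities:
  fixes F :: "nat \<Rightarrow> 'a::euclidean_space \<Rightarrow> 'a"
  assumes F: "\<And>i x. F i x = r i *\<^sub>R x + b i"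
    and r: "\<And>i. \<bar>r i\<bar> < 1"
    and sup: "\<not> (SUP i. \<bar>r i\<bar>) < 1"
    and E: "bounded E" "E \<noteq> {}" "\<And>i x. x \<in> E \<Longrightarrow> F i x \<in> E"
  obtains k :: "nat \<Rightarrow> nat" and s c where "\<bar>s\<bar> = 1"
    and "\<And>x. (\<lambda>n. F (k n) x) \<longlonglongrightarrow> s *\<^sub>R x + c"
proof -
  obtain e B where e: "e \<in> E" and B: "\<And>y. y \<in> E \<Longrightarrow> norm y \<le> B"
    using E(1,2) unfolding bounded_iff by blast
  have b: "norm (b i) \<le> 2 * B" for i
  proof -
    have "b i = F i e - r i *\<^sub>R e"
      by (simp add: F)
    moreover have "norm (r i *\<^sub>R e) \<le> 1 * norm e"
      unfolding norm_scaleR using r[of i] by (intro mult_right_mono) auto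
    ultimately show ?thesis
      using norm_triangle_ineq4[of "F i e" "r i *\<^sub>R e"] B[OF e] B[OF E(3)[OF e], of i] by simp
  qed
  have "\<exists>i. 1 - inverse (real (Suc n)) < \<bar>r i\<bar>" for n
  proof (rule ccontr)
    assume "\<not> ?thesis"
    then have "(SUP i. \<bar>r i\<bar>) \<le> 1 - inverse (real (Suc n))"
      by (intro cSUP_least) (auto simp: not_less)
    moreover have "inverse (real (Suc n)) > 0"
      by simp
    ultimately show False
      using sup by linarith
  qed
  then obtain j where j: "\<And>n. 1 - inverse (real (Suc n)) < \<bar>r (j n)\<bar>"
    by metis
  have "bounded (range (\<lambda>n. (r (j n), b (j n))))"
  proof (rule bounded_subset)
    show "bounded (cball 0 1 \<times> cball 0 (2 * B) :: (real \<times> 'a) set)"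
      by (intro bounded_Times bounded_cball)
    show "range (\<lambda>n. (r (j n), b (j n))) \<subseteq> cball 0 1 \<times> cball 0 (2 * B)"
      using less_imp_le[OF r] b by auto
  qed
  then obtain l f where f: "strict_mono f" and lim: "((\<lambda>n. (r (j n), b (j n))) \<circ> f) \<longlonglongrightarrow> l"
    using bounded_imp_convergent_subsequence by blast
  have s: "(\<lambda>n. r (j (f n))) \<longlonglongrightarrow> fst l" and c: "(\<lambda>n. b (j (f n))) \<longlonglongrightarrow> snd l"
    using tendsto_fst[OF lim] tendsto_snd[OF lim] by (simp_all add: o_def)
  have "(\<lambda>n. \<bar>r (j n)\<bar>) \<longlonglongrightarrow> 1"
  proof (rule tendsto_sandwich[OF _ _ _ tendsto_const])
    show "(\<lambda>n. 1 - inverse (real (Suc n))) \<longlonglongrightarrow> 1"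
      using tendsto_diff[OF tendsto_const[of 1] LIMSEQ_inverse_real_of_nat] by simp
  qed (use less_imp_le[OF j] less_imp_le[OF r] in \<open>simp_all del: of_nat_Suc\<close>)
  then have "(\<lambda>n. \<bar>r (j (f n))\<bar>) \<longlonglongrightarrow> 1"
    using LIMSEQ_subseq_LIMSEQ[OF _ f] by (auto simp: o_def)
  then have "\<bar>fst l\<bar> = 1"
    using tendsto_rabs[OF s] LIMSEQ_unique by blast
  moreover have "(\<lambda>n. F (j (f n)) x) \<longlonglongrightarrow> fst l *\<^sub>R x + snd l" for x
    unfolding F by (intro tendsto_intros s c)
  ultimately show ?thesis
    by (rule that)
qed

text \<open>
  The closed \<open>1\<close>-neighbourhood is written as a Minkowski sum with the unit ball: an affine map with
  linear part \<open>t\<close> acts on \<open>x + u\<close> as the map itself on \<open>x\<close> and as scaling by \<open>t\<close> on \<open>u\<close>.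
\<close>

lemma neighbourhood_invariant:
  fixes F :: "nat \<Rightarrow> 'a::euclidean_space \<Rightarrow> 'a"
  assumes F: "\<And>i x. F i x = r i *\<^sub>R x + b i"
    and r: "\<And>i. \<bar>r i\<bar> < 1"
    and sup: "\<not> (SUP i. \<bar>r i\<bar>) < 1"
    and E: "bounded E" "invariant_set F E"
  shows "invariant_set F {x + u |x u. x \<in> E \<and> u \<in> cball 0 1}" (is "invariant_set F ?N")
proof -
  have ne: "E \<noteq> {}"
    using E(2) by (simp add: invariant_set_def)
  note closedE = invariant_set_closed[OF E(2)] and FE = invariant_set_image[OF E(2)]
  have "compact E"
    using closedE E(1) by (simp add: compact_eq_bounded_closed)
  then have closedN: "closed ?N"
    by (rule compact_imp_closed[OF compact_sums[OF _ compact_cball]])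
  have affineN: "t *\<^sub>R y + a \<in> ?N"
    if "\<bar>t\<bar> \<le> 1" and t: "\<And>x. x \<in> E \<Longrightarrow> t *\<^sub>R x + a \<in> E" and y: "y \<in> ?N" for t a y
  proof -
    obtain x u where xu: "y = x + u" "x \<in> E" "norm u \<le> 1"
      using y by auto
    have "t *\<^sub>R y + a = (t *\<^sub>R x + a) + t *\<^sub>R u"
      by (simp add: xu(1) algebra_simps)
    moreover have "norm (t *\<^sub>R u) \<le> 1"
      using that(1) xu(3) by (simp add: mult_le_one)
    ultimately show ?thesis
      using t[OF xu(2)] unfolding mem_Collect_eq mem_cball_0 by blast
  qed
  have FN: "F i y \<in> ?N" if "y \<in> ?N" for i y
    unfolding F using r[of i] FE[of _ i] that by (intro affineN) (auto simp: F)
  \<comment> \<open>The limit map \<open>G x = s x + c\<close> preserves \<open>E\<close>, which forces \<open>G \<circ> G\<close> to be the identity.\<close>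
  obtain k s c where s: "\<bar>s\<bar> = 1" and lim: "\<And>x. (\<lambda>n. F (k n) x) \<longlonglongrightarrow> s *\<^sub>R x + c"
    using limit_of_similarities[OF F r sup E(1) ne FE] by metis
  have GE: "s *\<^sub>R x + c \<in> E" if "x \<in> E" for x
    by (rule closed_sequentially[OF closedE _ lim]) (rule FE[OF that])
  have ss: "s * s = 1"
    using s by (metis abs_mult_self_eq mult_1)
  then have GG: "s *\<^sub>R (s *\<^sub>R x + c) + c = x + (s *\<^sub>R c + c)" for x
    by (simp add: algebra_simps)
  have "s *\<^sub>R c + c = 0"
    by (rule translation_preserving_bounded_trivial[OF E(1) ne]) (metis GE GG)
  then have involution: "s *\<^sub>R (s *\<^sub>R x + c) + c = x" for x
    using GG by simp
  have "?N = closure (\<Union>i. F i ` ?N)"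
  proof
    show "closure (\<Union>i. F i ` ?N) \<subseteq> ?N"
      by (rule closure_minimal[OF _ closedN]) (use FN in blast)
    show "?N \<subseteq> closure (\<Union>i. F i ` ?N)"
    proof
      fix y assume "y \<in> ?N"
      then have "s *\<^sub>R y + c \<in> ?N"
        using s GE by (intro affineN) auto
      then have "F (k n) (s *\<^sub>R y + c) \<in> (\<Union>i. F i ` ?N)" for n
        by (intro UN_I[of "k n"] UNIV_I imageI)
      moreover have "(\<lambda>n. F (k n) (s *\<^sub>R y + c)) \<longlonglongrightarrow> y"
        using lim[of "s *\<^sub>R y + c"] by (simp only: involution)
      ultimately show "y \<in> closure (\<Union>i. F i ` ?N)"
        unfolding closure_sequential by (intro exI conjI allI)
    qed
  qed
  moreover have "?N \<noteq> {}"
  proof -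
    obtain x where "x \<in> E"
      using ne by blast
    moreover have "(0::'a) \<in> cball 0 1"
      by simp
    ultimately show ?thesis
      by blast
  qed
  ultimately show ?thesis
    unfolding invariant_set_def by blast
qed

theorem corollary2p13:
  fixes F :: "nat \<Rightarrow> real ^ 'n \<Rightarrow> real ^ 'n"
    and r :: "nat \<Rightarrow> real"
    and b :: "nat \<Rightarrow> real ^ 'n"
  assumes "\<And>i x. F i x = r i *\<^sub>R x + b i"
    and "\<And>i. \<bar>r i\<bar> < 1"
    and "\<exists>!E. bounded E \<and> invariant_set F E"
  shows "(SUP i. \<bar>r i\<bar>) < 1"
proof (rule ccontr)
  assume sup: "\<not> (SUP i. \<bar>r i\<bar>) < 1"
  obtain E where E: "bounded E" "invariant_set F E"
    and unique: "\<And>E'. bounded E' \<Longrightarrow> invariant_set F E' \<Longrightarrow> E' = E"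
    using assms(3) by blast
  have "{x + u |x u. x \<in> E \<and> u \<in> cball 0 1} = E"
  proof (rule unique)
    show "bounded {x + u |x u. x \<in> E \<and> u \<in> cball 0 1}"
      by (rule compact_imp_bounded[OF compact_sums[OF _ compact_cball]])
        (use E(1) invariant_set_closed[OF E(2)] in \<open>simp add: compact_eq_bounded_closed\<close>)
    show "invariant_set F {x + u |x u. x \<in> E \<and> u \<in> cball 0 1}"
      by (rule neighbourhood_invariant[OF assms(1,2) sup E])
  qed
  then have "x + u \<in> E" if "x \<in> E" "norm u \<le> 1" for x u
    using that unfolding mem_cball_0 by blast
  moreover obtain v :: "real ^ 'n" where "norm v = 1"
    using vector_choose_size[of 1] zero_le_one by blast
  moreover have "E \<noteq> {}"
    using E(2) by (simp add: invariant_set_def)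
  ultimately have "v = 0"
    by (intro translation_preserving_bounded_trivial[OF E(1)]) simp_all
  with \<open>norm v = 1\<close> show False
    by simp
qed

end
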